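(* Let $T, S:\mathbb{T}^2 \rightarrow \mathbb{T}^2$ be hyperbolic toral automorphisms of the $2$-torus $\mathbb{T}^2=\mathbb{R}^2/\mathbb{Z}^2$. If $\dim(E_T^- \cap E_S^-) = 0$, then $ND(T) \cap D(S)$ is a dense, uncountable subset of $\mathbb{T}^2$.
   Context: A hyperbolic toral automorphism of $\mathbb{T}^2=\mathbb{R}^2/\mathbb{Z}^2$ is the map induced by a matrix in $GL_2(\mathbb{Z})$ with no eigenvalue of absolute value $1$. For such a map $g$, $E_g^-$ denotes the stable manifold of $g$ through the origin $\boldsymbol{0}\in\mathbb{T}^2$, i.e. the set of $y\in\mathbb{T}^2$ whose iterates $g^n(y)$ converge to $\boldsymbol{0}$ as $n\to+\infty$; it is the image in $\mathbb{T}^2$ of the contracting eigenline of the matrix. The condition $\dim(E_T^-\cap E_S^-)=0$ means that the contracting eigenlines of the two matrices are distinct (equivalently, $E_T^-\cap E_S^-$ is countable). For a map $f:X\to X$ of a topological space, a point $x$ has dense forward orbit if the closure of $\{f^n(x): n\ge 0\}$ is $X$, and nondense forward orbit otherwise. $D(f)$ is the set of points with dense forward orbit under $f$, and $ND(f)$ is the set of points with nondense forward orbit under $f$. *)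

theory Defs
  imports "HOL-Analysis.Analysis"
begin

definition int_lattice_rel :: "real^2 \<Rightarrow> real^2 \<Rightarrow> bool" where
  "int_lattice_rel x y \<longleftrightarrow> (\<forall>i. x $ i - y $ i \<in> \<int>)"

quotient_type torus2 = "real^2" / int_lattice_rel
  morphisms rep_torus2 torus_proj
proof (rule equivpI)
  show "reflp int_lattice_rel"
    by (auto simp: reflp_def int_lattice_rel_def)
  show "symp int_lattice_rel"
    unfolding symp_def int_lattice_rel_def by (metis Ints_minus minus_diff_eq)
  show "transp int_lattice_rel"
    unfolding transp_def int_lattice_rel_def
    by (metis Ints_add add_diff_eq diff_add_cancel)
qed

lemma torus_proj_eq_iff: "torus_proj x = torus_proj y \<longleftrightarrow> (\<forall>i. x $ i - y $ i \<in> \<int>)"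
  using torus2.abs_eq_iff int_lattice_rel_def by simp

instantiation torus2 :: topological_space
begin

definition open_torus2 :: "torus2 set \<Rightarrow> bool" where
  "open_torus2 U \<longleftrightarrow> open (torus_proj -` U)"

instance
proof
  fix K :: "torus2 set set"
  assume "\<forall>S\<in>K. open S"
  then show "open (\<Union>K)"
    by (auto simp: open_torus2_def vimage_Union)
qed (auto simp: open_torus2_def)

end

lift_definition toral_map :: "int^2^2 \<Rightarrow> torus2 \<Rightarrow> torus2"
  is "\<lambda>A x. map_matrix real_of_int A *v x"
proof -
  fix A :: "int^2^2" and x y :: "real^2"
  assume "int_lattice_rel x y"
  then show "int_lattice_rel (map_matrix real_of_int A *v x) (map_matrix real_of_int A *v y)"
    unfolding int_lattice_rel_def
    by (auto simp: matrix_vector_mult_def simp flip: sum_subtractf right_diff_distrib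
             intro!: Ints_sum Ints_mult)
qed

text \<open>For a matrix over \<^typ>\<open>int\<close>, \<^const>\<open>invertible\<close> asks for an inverse over
  \<^typ>\<open>int\<close>, so it expresses membership in \<open>GL\<^sub>2(\<int>)\<close>.\<close>

definition hyperbolic_matrix :: "int^2^2 \<Rightarrow> bool" where
  "hyperbolic_matrix A \<longleftrightarrow> invertible A \<and>
     (\<forall>(c::complex) v. v \<noteq> 0 \<and> map_matrix complex_of_int A *v v = c *s v \<longrightarrow> cmod c \<noteq> 1)"

definition hyperbolic_toral_automorphism :: "(torus2 \<Rightarrow> torus2) \<Rightarrow> bool" where
  "hyperbolic_toral_automorphism g \<longleftrightarrow> (\<exists>A. hyperbolic_matrix A \<and> g = toral_map A)"

definition stable_manifold :: "(torus2 \<Rightarrow> torus2) \<Rightarrow> torus2 set" where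
  "stable_manifold g = {y. (\<lambda>n. (g ^^ n) y) \<longlonglongrightarrow> torus_proj 0}"

text \<open>Stable manifolds through the origin are injectively immersed, dense subgroups of the torus.
  The dimension of their intersection is therefore that of an immersed subgroup, i.e. the
  dimension of the space of directions \<open>v\<close> whose one-parameter subgroup \<open>t \<mapsto> t v\<close>
  (mod \<open>\<int>\<^sup>2\<close>) stays inside it.\<close>

definition immersed_dim :: "torus2 set \<Rightarrow> nat" where
  "immersed_dim H = dim {v::real^2. \<forall>t::real. torus_proj (t *\<^sub>R v) \<in> H}"

definition D :: "('a::topological_space \<Rightarrow> 'a) \<Rightarrow> 'a set" where
  "D f = {x. closure (range (\<lambda>n. (f ^^ n) x)) = UNIV}"

definition ND :: "('a::topological_space \<Rightarrow> 'a) \<Rightarrow> 'a set" where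
  "ND f = {x. closure (range (\<lambda>n. (f ^^ n) x)) \<noteq> UNIV}"

definition contracting_eigenline :: "int^2^2 \<Rightarrow> (real^2) set" where
  "contracting_eigenline A =
     {v. \<exists>c::real. \<bar>c\<bar> < 1 \<and> map_matrix real_of_int A *v v = c *\<^sub>R v}"

lemma eigenvector_2x2:
  fixes M :: "'a::field^2^2"
  assumes c: "(M$1$1 - c) * (M$2$2 - c) = M$1$2 * M$2$1"
  shows "\<exists>v. v \<noteq> 0 \<and> M *v v = c *s v"
proof -
  consider "M$1$2 \<noteq> 0 \<or> M$1$1 \<noteq> c" | "M$1$2 = 0" "M$1$1 = c" "M$2$2 \<noteq> c \<or> M$2$1 \<noteq> 0"
    | "M$1$2 = 0" "M$1$1 = c" "M$2$2 = c" "M$2$1 = 0" by blast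
  then show ?thesis
  proof cases
    case 1
    have "M *v vector [M$1$2, c - M$1$1] = c *s vector [M$1$2, c - M$1$1]"
      using c by (simp add: vec_eq_iff forall_2 matrix_vector_mult_def sum_2 algebra_simps)
    moreover have "vector [M$1$2, c - M$1$1] \<noteq> (0::'a^2)"
      using 1 by (auto simp: vec_eq_iff forall_2)
    ultimately show ?thesis by blast
  next
    case 2
    have "M *v vector [c - M$2$2, M$2$1] = c *s vector [c - M$2$2, M$2$1]"
      using 2 by (simp add: vec_eq_iff forall_2 matrix_vector_mult_def sum_2 algebra_simps)
    moreover have "vector [c - M$2$2, M$2$1] \<noteq> (0::'a^2)"
      using 2 by (auto simp: vec_eq_iff forall_2)
    ultimately show ?thesis by blast
  next
    case 3
    have "M *v vector [1, 0] = c *s vector [1, 0]"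
      using 3 by (simp add: vec_eq_iff forall_2 matrix_vector_mult_def sum_2)
    moreover have "vector [1, 0] \<noteq> (0::'a^2)"
      by (auto simp: vec_eq_iff forall_2)
    ultimately show ?thesis by blast
  qed
qed

lemma hyperbolic_real_eigenvalues:
  assumes "hyperbolic_matrix A"
  defines "M \<equiv> map_matrix real_of_int A"
  obtains l m :: real where "\<bar>l\<bar> < 1" "1 < \<bar>m\<bar>" "l + m = M$1$1 + M$2$2"
    "l * m = M$1$1 * M$2$2 - M$1$2 * M$2$1" "l * m \<noteq> 0"
proof -
  define t d where "t = M$1$1 + M$2$2" and "d = M$1$1 * M$2$2 - M$1$2 * M$2$1"
  obtain B where "A ** B = mat 1"
    using assms by (auto simp: hyperbolic_matrix_def invertible_def)
  then have "det A * det B = 1"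
    by (metis det_mul det_I)
  then have "\<bar>det A\<bar> = 1"
    by (metis dvd_triv_left zdvd1_eq)
  moreover have "d = real_of_int (det A)"
    by (simp add: d_def M_def det_2)
  ultimately have d: "\<bar>d\<bar> = 1"
    by (metis of_int_1 of_int_abs)
  have eig: "cmod c \<noteq> 1" if "c\<^sup>2 - complex_of_real t * c + complex_of_real d = 0" for c
  proof -
    let ?C = "map_matrix complex_of_int A"
    have "(?C$1$1 - c) * (?C$2$2 - c) = ?C$1$2 * ?C$2$1"
      using that by (simp add: t_def d_def M_def algebra_simps power2_eq_square)
    from eigenvector_2x2[OF this] show ?thesis
      using assms by (auto simp: hyperbolic_matrix_def)
  qed
  have disc: "0 \<le> t\<^sup>2 - 4 * d"
  proof (rule ccontr)
    assume "\<not> 0 \<le> t\<^sup>2 - 4 * d"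
    then have neg: "t\<^sup>2 - 4 * d < 0" by simp
    then have "d > 0"
      by (smt (verit) zero_le_power2)
    then have "d = 1" using d by simp
    define s where "s = sqrt (4 - t\<^sup>2) / 2"
    have s2: "s\<^sup>2 = 1 - t\<^sup>2 / 4"
      using neg \<open>d = 1\<close> by (simp add: s_def power_divide)
    define c where "c = Complex (t/2) s"
    have "c\<^sup>2 - complex_of_real t * c + complex_of_real d = 0"
      using s2 \<open>d = 1\<close> by (simp add: c_def complex_eq_iff power2_eq_square)
    moreover have "cmod c = 1"
      using s2 by (simp add: c_def cmod_def power_divide)
    ultimately show False using eig by blast
  qed
  define r where "r = sqrt (t\<^sup>2 - 4 * d)"
  have r2: "r * r = t * t - 4 * d"
    using disc by (simp add: r_def power2_eq_square)
  define p q where "p = (t + r) / 2" and "q = (t - r) / 2"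
  have sum: "p + q = t" by (simp add: p_def q_def field_simps)
  have prod: "p * q = d" using r2 by (simp add: p_def q_def algebra_simps)
  have *: "\<bar>x\<bar> \<noteq> 1" if "x + y = t" "x * y = d" for x y
  proof -
    have "x\<^sup>2 - t * x + d = 0"
      by (simp add: that[symmetric] power2_eq_square algebra_simps)
    then have "complex_of_real (x\<^sup>2 - t * x + d) = 0" by simp
    then have "(complex_of_real x)\<^sup>2 - complex_of_real t * complex_of_real x + complex_of_real d = 0"
      by simp
    from eig[OF this] show ?thesis by simp
  qed
  have p1: "\<bar>p\<bar> \<noteq> 1" using * sum prod by blast
  have pq: "\<bar>p\<bar> * \<bar>q\<bar> = 1" using prod d by (metis abs_mult)
  show thesis
  proof (cases "\<bar>p\<bar> < 1")
    case True
    then have "1 < \<bar>q\<bar>" using pq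
      by (smt (verit) mult_less_cancel_right1 mult_eq_0_iff mult_left_le)
    with True show ?thesis using that[of p q] sum prod d by (auto simp: t_def d_def)
  next
    case False
    then have "1 < \<bar>p\<bar>" using p1 by simp
    moreover from this have "\<bar>q\<bar> < 1" using pq
      by (smt (verit) mult_less_cancel_right1 mult_eq_0_iff mult_left_le)
    ultimately show ?thesis using that[of q p] sum prod d
      by (auto simp: t_def d_def mult.commute add.commute)
  qed
qed

definition iter_mat :: "real^2^2 \<Rightarrow> nat \<Rightarrow> real^2 \<Rightarrow> real^2" where
  "iter_mat M n = (((*v) M) ^^ n)"

lemma iter_mat_eig: "M *v v = c *\<^sub>R v \<Longrightarrow> iter_mat M n v = c ^ n *\<^sub>R v"
  by (induction n) (auto simp: iter_mat_def matrix_vector_mult_scaleR)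

lemma iter_mat_diff: "iter_mat M n (v - w) = iter_mat M n v - iter_mat M n w"
  by (induction n) (auto simp: iter_mat_def matrix_vector_mult_diff_distrib)

lemma iter_mat_scaleR: "iter_mat M n (c *\<^sub>R v) = c *\<^sub>R iter_mat M n v"
  by (induction n) (auto simp: iter_mat_def matrix_vector_mult_scaleR)

lemma iter_mat_commute: "iter_mat M n (M *v v) = M *v iter_mat M n v"
  by (simp add: iter_mat_def funpow_swap1)

lemma contracting_eigenline_eqs:
  assumes A: "hyperbolic_matrix A"
  defines "M \<equiv> map_matrix real_of_int A"
  shows contracting_eigenline_dynamic:
      "v \<in> contracting_eigenline A \<longleftrightarrow> (\<lambda>n. iter_mat M n v) \<longlonglongrightarrow> 0"
    and subspace_contracting_eigenline: "subspace (contracting_eigenline A)"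
    and dim_contracting_eigenline: "dim (contracting_eigenline A) = 1"
proof -
  obtain l m :: real where l: "\<bar>l\<bar> < 1" and m: "1 < \<bar>m\<bar>" and tr: "l + m = M$1$1 + M$2$2"
    and dt: "l * m = M$1$1 * M$2$2 - M$1$2 * M$2$1"
    using hyperbolic_real_eigenvalues[OF A] unfolding M_def by blast
  have CH: "M *v (M *v v - l *\<^sub>R v) = m *\<^sub>R (M *v v - l *\<^sub>R v)" for v
  proof -
    have 1: "M$2$2 = l + m - M$1$1" using tr by simp
    have 2: "M$1$2 * M$2$1 = M$1$1 * (l + m - M$1$1) - l * m" using dt 1 by simp
    have "M *v (M *v v) + (l * m) *\<^sub>R v = (l + m) *\<^sub>R (M *v v)"
      unfolding tr dt
      by (simp add: vec_eq_iff forall_2 matrix_vector_mult_def sum_2 algebra_simps)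
    then show ?thesis
      by (simp add: matrix_vector_mult_diff_distrib matrix_vector_mult_scaleR algebra_simps)
  qed
  have to0: "(\<lambda>n. iter_mat M n v) \<longlonglongrightarrow> 0" if "\<bar>c\<bar> < 1" "M *v v = c *\<^sub>R v" for v c
  proof -
    have "(\<lambda>n. c ^ n *\<^sub>R v) \<longlonglongrightarrow> 0 *\<^sub>R v"
      using that(1) by (intro tendsto_scaleR LIMSEQ_power_zero tendsto_const) auto
    then show ?thesis using iter_mat_eig[OF that(2)] by simp
  qed
  have from0: "M *v v = l *\<^sub>R v" if lim: "(\<lambda>n. iter_mat M n v) \<longlonglongrightarrow> 0" for v
  proof -
    let ?q = "M *v v - l *\<^sub>R v"
    have "(\<lambda>n. M *v iter_mat M n v - l *\<^sub>R iter_mat M n v) \<longlonglongrightarrow> M *v 0 - l *\<^sub>R 0"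
      by (intro tendsto_diff tendsto_scaleR tendsto_const lim
          bounded_linear.tendsto[OF matrix_vector_mul_bounded_linear])
    then have "(\<lambda>n. iter_mat M n ?q) \<longlonglongrightarrow> 0"
      by (simp add: iter_mat_diff iter_mat_scaleR iter_mat_commute)
    then have "(\<lambda>n. norm (m ^ n *\<^sub>R ?q)) \<longlonglongrightarrow> 0"
      unfolding iter_mat_eig[OF CH] by (rule tendsto_norm_zero)
    moreover have "norm ?q \<le> norm (m ^ n *\<^sub>R ?q)" for n
      using m by (simp add: power_abs mult_le_cancel_right1)
    ultimately have "norm ?q \<le> 0"
      by (meson LIMSEQ_le_const)
    then show ?thesis by simp
  qed
  show dyn: "v \<in> contracting_eigenline A \<longleftrightarrow> (\<lambda>n. iter_mat M n v) \<longlonglongrightarrow> 0" for v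
    using to0 from0 l by (auto simp: contracting_eigenline_def simp flip: M_def)
  have eq: "contracting_eigenline A = {v. M *v v = l *\<^sub>R v}"
    using dyn to0 from0 l by blast
  show sub: "subspace (contracting_eigenline A)"
    unfolding eq subspace_def
    by (auto simp: matrix_vector_right_distrib matrix_vector_mult_scaleR algebra_simps)
  have "(M$1$1 - l) * (M$2$2 - l) = M$1$2 * M$2$1" "(M$1$1 - m) * (M$2$2 - m) = M$1$2 * M$2$1"
    using dt tr by algebra+
  then obtain u w where u: "u \<noteq> 0" "M *v u = l *\<^sub>R u" and w: "w \<noteq> 0" "M *v w = m *\<^sub>R w"
    using eigenvector_2x2 by (metis scalar_mult_eq_scaleR)
  have "l \<noteq> m" using l m by auto
  with w have wn: "w \<notin> contracting_eigenline A" by (auto simp: eq)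
  have "dim (contracting_eigenline A) \<noteq> 2"
  proof
    assume "dim (contracting_eigenline A) = 2"
    then have "span (contracting_eigenline A) = UNIV"
      using dim_eq_full[of "contracting_eigenline A"] by simp
    moreover have "span (contracting_eigenline A) = contracting_eigenline A"
      using sub span_eq_iff by metis
    ultimately show False using wn by blast
  qed
  moreover have "dim (contracting_eigenline A) \<noteq> 0"
    using u by (auto simp: dim_eq_0 eq)
  moreover have "dim (contracting_eigenline A) \<le> 2"
    using dim_subset_UNIV[of "contracting_eigenline A"] by simp
  ultimately show "dim (contracting_eigenline A) = 1" by linarith
qed

lemma toral_map_funpow:
  "(toral_map A ^^ n) (torus_proj v) = torus_proj (iter_mat (map_matrix real_of_int A) n v)"
  by (induction n) (auto simp: iter_mat_def toral_map.abs_eq)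

lemma open_torus_proj_image:
  assumes "open U" shows "open (torus_proj ` U)"
proof -
  have "torus_proj -` torus_proj ` U = (\<Union>z\<in>{z. \<forall>i. z $ i \<in> \<int>}. (+) z ` U)"
  proof (intro set_eqI iffI)
    fix x assume "x \<in> torus_proj -` torus_proj ` U"
    then obtain u where "u \<in> U" "\<forall>i. x $ i - u $ i \<in> \<int>"
      by (auto simp: torus_proj_eq_iff)
    then show "x \<in> (\<Union>z\<in>{z. \<forall>i. z $ i \<in> \<int>}. (+) z ` U)"
      by (intro UN_I[of "x - u"]) (auto intro!: image_eqI[of _ _ u])
  next
    fix x assume "x \<in> (\<Union>z\<in>{z. \<forall>i. z $ i \<in> \<int>}. (+) z ` U)"
    then obtain z u where "u \<in> U" "\<forall>i. z $ i \<in> \<int>" "x = z + u" by auto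
    then show "x \<in> torus_proj -` torus_proj ` U"
      by (auto simp: torus_proj_eq_iff intro!: image_eqI[of _ _ u])
  qed
  then show ?thesis
    using assms by (auto simp: open_torus2_def intro!: open_UN open_translation)
qed

definition round_vec :: "real^2 \<Rightarrow> int^2" where
  "round_vec x = (\<chi> i. round (x $ i))"

definition real_vec :: "int^2 \<Rightarrow> real^2" where
  "real_vec z = (\<chi> i. real_of_int (z $ i))"

lemma torus_tendsto_0_iff:
  "((\<lambda>n. torus_proj (x n)) \<longlonglongrightarrow> torus_proj 0) \<longleftrightarrow>
   (\<lambda>n. x n - real_vec (round_vec (x n))) \<longlonglongrightarrow> 0"
proof
  assume L: "(\<lambda>n. torus_proj (x n)) \<longlonglongrightarrow> torus_proj 0"
  show "(\<lambda>n. x n - real_vec (round_vec (x n))) \<longlonglongrightarrow> 0"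
  proof (rule vec_tendstoI, rule tendstoI)
    fix i and e :: real assume "e > 0"
    then have "open (torus_proj ` ball 0 e)" "torus_proj 0 \<in> torus_proj ` ball 0 e"
      by (auto intro: open_torus_proj_image)
    from topological_tendstoD[OF L this]
    show "\<forall>\<^sub>F n in sequentially.
        dist ((x n - real_vec (round_vec (x n))) $ i) ((0::real^2) $ i) < e"
    proof eventually_elim
      case (elim n)
      then obtain u where u: "norm u < e" "\<forall>i. x n $ i - u $ i \<in> \<int>"
        by (auto simp: torus_proj_eq_iff)
      then obtain k where "x n $ i - u $ i = of_int k" by (meson Ints_cases)
      then have "\<bar>x n $ i - of_int (round (x n $ i))\<bar> \<le> \<bar>u $ i\<bar>"
        using round_diff_minimal[of "x n $ i" k] by (simp add: algebra_simps)
      also have "\<dots> < e" using u component_le_norm_cart[of u i] by simp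
      finally show ?case
        by (simp add: real_vec_def round_vec_def dist_real_def)
    qed
  qed
next
  assume L: "(\<lambda>n. x n - real_vec (round_vec (x n))) \<longlonglongrightarrow> 0"
  have eq: "torus_proj (x n - real_vec (round_vec (x n))) = torus_proj (x n)" for n
    by (auto simp: torus_proj_eq_iff real_vec_def)
  show "(\<lambda>n. torus_proj (x n)) \<longlonglongrightarrow> torus_proj 0"
  proof (rule topological_tendstoI)
    fix U assume "open U" "torus_proj 0 \<in> U"
    then have "open (torus_proj -` U)" "0 \<in> torus_proj -` U" by (auto simp: open_torus2_def)
    from topological_tendstoD[OF L this]
    show "\<forall>\<^sub>F n in sequentially. torus_proj (x n) \<in> U"
      by (simp add: eq)
  qed
qed

text \<open>The stable manifold is the image of the contracting eigenline.\<close>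

lemma stable_manifold_toral_map:
  assumes A: "hyperbolic_matrix A"
  shows "stable_manifold (toral_map A) = torus_proj ` contracting_eigenline A"
proof (intro set_eqI iffI)
  fix y assume "y \<in> torus_proj ` contracting_eigenline A"
  then obtain v where v: "v \<in> contracting_eigenline A" and y: "y = torus_proj v" by blast
  have "((\<lambda>n. torus_proj (iter_mat (map_matrix real_of_int A) n v)) \<longlonglongrightarrow> torus_proj 0)"
  proof (rule topological_tendstoI)
    fix U assume "open U" "torus_proj 0 \<in> U"
    then have "open (torus_proj -` U)" "0 \<in> torus_proj -` U" by (auto simp: open_torus2_def)
    then show "\<forall>\<^sub>F n in sequentially. torus_proj (iter_mat (map_matrix real_of_int A) n v) \<in> U"
      using topological_tendstoD contracting_eigenline_dynamic[OF A, of v] v by fastforce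
  qed
  then show "y \<in> stable_manifold (toral_map A)"
    by (simp add: stable_manifold_def y toral_map_funpow)
next
  fix y assume y: "y \<in> stable_manifold (toral_map A)"
  obtain v where v: "y = torus_proj v" by (rule torus2.abs_induct[of "\<lambda>y. \<exists>v. y = torus_proj v" y, THEN exE]) blast+
  define M where "M = map_matrix real_of_int A"
  define x where "x n = iter_mat M n v" for n
  define z where "z n = round_vec (x n)" for n
  define e where "e n = x n - real_vec (z n)" for n
  have e0: "e \<longlonglongrightarrow> 0"
    using y torus_tendsto_0_iff[of x]
    by (simp add: stable_manifold_def v toral_map_funpow e_def[abs_def] z_def x_def M_def)
  have Mr: "M *v real_vec k = real_vec (A *v k)" for k
    by (simp add: vec_eq_iff M_def real_vec_def matrix_vector_mult_def)
  have xS: "x (Suc n) = M *v x n" for n by (simp add: x_def iter_mat_def)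
  have diff: "real_vec (A *v z n) - real_vec (z (Suc n)) = e (Suc n) - M *v e n" for n
    by (simp add: e_def xS matrix_vector_mult_diff_distrib Mr)
  have "(\<lambda>n. e (Suc n) - M *v e n) \<longlonglongrightarrow> 0 - M *v 0"
    by (intro tendsto_diff LIMSEQ_Suc e0
        bounded_linear.tendsto[OF matrix_vector_mul_bounded_linear])
  then have "(\<lambda>n. e (Suc n) - M *v e n) \<longlonglongrightarrow> 0" by simp
  from tendstoD[OF this, of 1] obtain N where N: "\<And>n. n \<ge> N \<Longrightarrow> norm (e (Suc n) - M *v e n) < 1"
    by (auto simp: eventually_sequentially)
  have zS: "z (Suc n) = A *v z n" if "n \<ge> N" for n
  proof -
    have "\<bar>real_of_int ((A *v z n) $ i) - real_of_int (z (Suc n) $ i)\<bar> < 1" for i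
      using N[OF that] component_le_norm_cart[of "e (Suc n) - M *v e n" i]
      by (simp flip: diff add: real_vec_def)
    then have "\<bar>(A *v z n) $ i - z (Suc n) $ i\<bar> < 1" for i
      by (metis of_int_diff of_int_abs of_int_less_1_iff)
    then show ?thesis by (simp add: vec_eq_iff)
  qed
  obtain B where AB: "A ** B = mat 1" "B ** A = mat 1"
    using A by (auto simp: hyperbolic_matrix_def invertible_def)
  define k where "k = (((*v) B) ^^ N) (z N)"
  have shift: "(((*v) A) ^^ n) ((((*v) B) ^^ n) w) = w" for n w
  proof (induction n arbitrary: w)
    case (Suc n)
    show ?case by (simp add: funpow_swap1[of "(*v) A"] matrix_vector_mul_assoc AB Suc)
  qed simp
  have itk: "(((*v) A) ^^ (N + n)) k = z (N + n)" for n
    by (induction n) (auto simp: k_def shift zS)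
  have itr: "iter_mat M n (real_vec k) = real_vec ((((*v) A) ^^ n) k)" for n
    by (induction n) (auto simp: iter_mat_def Mr)
  have "iter_mat M (N + n) (v - real_vec k) = e (N + n)" for n
    by (simp add: iter_mat_diff itr itk e_def x_def)
  then have "(\<lambda>n. iter_mat M (n + N) (v - real_vec k)) \<longlonglongrightarrow> 0"
    using LIMSEQ_ignore_initial_segment[OF e0, of N] by (simp add: add.commute)
  then have "(\<lambda>n. iter_mat M n (v - real_vec k)) \<longlonglongrightarrow> 0"
    by (rule LIMSEQ_offset)
  then have "v - real_vec k \<in> contracting_eigenline A"
    using contracting_eigenline_dynamic[OF A] by (simp add: M_def)
  moreover have "torus_proj (v - real_vec k) = y"
    by (auto simp: v torus_proj_eq_iff real_vec_def)
  ultimately show "y \<in> torus_proj ` contracting_eigenline A" by blast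
qed

lemma countable_int_vec: "countable (UNIV :: (int^2) set)"
proof -
  have "inj (\<lambda>z::int^2. (z $ 1, z $ 2))"
    by (auto simp: inj_def vec_eq_iff forall_2)
  then show ?thesis by (rule countableI')
qed

lemma directions_stable_manifold:
  assumes A: "hyperbolic_matrix A"
  shows "(\<forall>t::real. torus_proj (t *\<^sub>R v) \<in> stable_manifold (toral_map A)) \<longleftrightarrow>
         v \<in> contracting_eigenline A"
proof
  assume "v \<in> contracting_eigenline A"
  then show "\<forall>t::real. torus_proj (t *\<^sub>R v) \<in> stable_manifold (toral_map A)"
    using subspace_contracting_eigenline[OF A] stable_manifold_toral_map[OF A]
    by (auto simp: subspace_def)
next
  let ?L = "contracting_eigenline A"
  assume *: "\<forall>t::real. torus_proj (t *\<^sub>R v) \<in> stable_manifold (toral_map A)"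
  have "\<exists>z. t *\<^sub>R v - real_vec z \<in> ?L" for t :: real
  proof -
    obtain u where u: "u \<in> ?L" "\<forall>i. (t *\<^sub>R v) $ i - u $ i \<in> \<int>"
      using * stable_manifold_toral_map[OF A] by (auto simp: torus_proj_eq_iff dest!: spec[of _ t])
    have "t *\<^sub>R v - real_vec (\<chi> i. \<lfloor>(t *\<^sub>R v) $ i - u $ i\<rfloor>) = u"
      using u(2) by (simp add: vec_eq_iff real_vec_def)
    then show ?thesis using u(1) by metis
  qed
  then obtain z where z: "\<And>t::real. t *\<^sub>R v - real_vec (z t) \<in> ?L" by metis
  have "\<not> inj z"
  proof
    assume "inj z"
    moreover have "countable (range z)"
      using countable_int_vec countable_subset by blast
    ultimately have "countable (UNIV :: real set)"
      by (rule countable_image_inj_on[rotated])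
    then show False using uncountable_UNIV_real by blast
  qed
  then obtain s t where st: "s \<noteq> t" "z s = z t" by (auto simp: inj_def)
  have "(s *\<^sub>R v - real_vec (z s)) - (t *\<^sub>R v - real_vec (z t)) \<in> ?L"
    using z subspace_diff subspace_contracting_eigenline[OF A] by blast
  then have "(s - t) *\<^sub>R v \<in> ?L" using st by (simp add: algebra_simps)
  then have "(1 / (s - t)) *\<^sub>R (s - t) *\<^sub>R v \<in> ?L"
    using subspace_scale subspace_contracting_eigenline[OF A] by blast
  then show "v \<in> ?L" using st by simp
qed

text \<open>Hence the vanishing of the dimension says exactly that the contracting eigenlines differ.\<close>

theorem immersed_dim_stable_eq_0_iff:
  assumes A: "hyperbolic_matrix A" and B: "hyperbolic_matrix B"
  shows "immersed_dim (stable_manifold (toral_map A) \<inter> stable_manifold (toral_map B)) = 0 \<longleftrightarrow>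
         contracting_eigenline A \<noteq> contracting_eigenline B"
proof -
  let ?I = "contracting_eigenline A \<inter> contracting_eigenline B"
  have "immersed_dim (stable_manifold (toral_map A) \<inter> stable_manifold (toral_map B)) = dim ?I"
    unfolding immersed_dim_def
    using directions_stable_manifold[OF A] directions_stable_manifold[OF B]
    by (intro arg_cong[of _ _ dim]) auto
  moreover have "dim ?I = 0 \<longleftrightarrow> contracting_eigenline A \<noteq> contracting_eigenline B"
  proof
    assume "dim ?I = 0"
    then show "contracting_eigenline A \<noteq> contracting_eigenline B"
      using dim_contracting_eigenline[OF A] by (metis inf.idem zero_neq_one)
  next
    assume ne: "contracting_eigenline A \<noteq> contracting_eigenline B"
    note sA = subspace_contracting_eigenline[OF A] and sB = subspace_contracting_eigenline[OF B]
    note sI = subspace_inter[OF sA sB]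
    show "dim ?I = 0"
    proof (rule ccontr)
      assume "dim ?I \<noteq> 0"
      then have "1 \<le> dim ?I" by linarith
      then have "?I = contracting_eigenline A" "?I = contracting_eigenline B"
        using subspace_dim_equal[OF sI sA] subspace_dim_equal[OF sI sB]
          dim_contracting_eigenline[OF A] dim_contracting_eigenline[OF B] by auto
      with ne show False by blast
    qed
  qed
  ultimately show ?thesis by simp
qed

end

theory Submission
  imports Defs
begin

text \<open>Translating a point along the contracting eigenline of a matrix changes its forward orbit
  only by a null sequence. Hence a point \<open>p + t\<close> with \<open>p\<close> rational (so periodic) and \<open>t\<close> on the
  eigenline of \<open>T\<close> lies in \<open>ND T\<close>, and a point \<open>q + s\<close> lies in \<open>D S\<close> whenever the \<open>S\<close>-orbit of
  \<open>q\<close> visits every open set infinitely often and \<open>s\<close> is on the eigenline of \<open>S\<close>. As the two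
  eigenlines are transverse, the lines through \<open>p\<close> and \<open>q\<close> meet, and they meet near \<open>p\<close> if \<open>q\<close> is
  near \<open>p\<close>. By Baire's theorem \<open>q\<close> can be chosen near \<open>p\<close> and off any given countable
  family of lines parallel to the eigenline of \<open>S\<close>, which yields density and uncountability
  together. The topological transitivity of \<open>S\<close> that Baire's theorem needs comes from points that
  are backward asymptotic to one periodic point and forward asymptotic to another.\<close>

section \<open>Fibres of the projection and points of the torus\<close>

lemma torus_proj_rep_torus2: "torus_proj (rep_torus2 y) = y"
  by (rule Quotient_abs_rep[OF Quotient_torus2])

lemma torus_proj_add_cong:
  assumes "torus_proj x = torus_proj x'"
  shows "torus_proj (x + y) = torus_proj (x' + y)"
  using assms by (simp add: torus_proj_eq_iff)

text \<open>Each fibre is a translate of the countable integer lattice, so avoiding a countable set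
  of torus points amounts to avoiding a countable set in the plane.\<close>

lemma countable_torus_proj_vimage:
  assumes "countable C"
  shows "countable (torus_proj -` C)"
proof -
  have "torus_proj -` C \<subseteq> (\<Union>y\<in>C. range (\<lambda>z. rep_torus2 y + real_vec z))"
  proof
    fix x assume x: "x \<in> torus_proj -` C"
    have "\<forall>i. x $ i - rep_torus2 (torus_proj x) $ i \<in> \<int>"
      by (metis torus_proj_rep_torus2 torus_proj_eq_iff)
    then have "x = rep_torus2 (torus_proj x) +
        real_vec (\<chi> i. \<lfloor>x $ i - rep_torus2 (torus_proj x) $ i\<rfloor>)"
      by (simp add: vec_eq_iff real_vec_def)
    with x show "x \<in> (\<Union>y\<in>C. range (\<lambda>z. rep_torus2 y + real_vec z))" by blast
  qed
  moreover have "countable (\<Union>y\<in>C. range (\<lambda>z. rep_torus2 y + real_vec z))"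
    using assms countable_int_vec by (intro countable_UN countable_image)
  ultimately show ?thesis by (rule countable_subset)
qed

lemma open_minus_countable_nonempty:
  fixes U :: "'a::euclidean_space set"
  assumes "open U" "U \<noteq> {}" "countable C"
  shows "U - C \<noteq> {}"
proof -
  obtain x r where "r > 0" "ball x r \<subseteq> U"
    using assms(1,2) by (meson ex_in_conv openE)
  then have "uncountable U" using uncountable_ball countable_subset by blast
  then show ?thesis using assms(3) by (metis Diff_eq_empty_iff countable_subset)
qed

text \<open>The fibre is cut out by one condition per coordinate, closed because
  \<open>\<int>\<close> is closed. This lets finitely many torus points be deleted from an open
  set.\<close>

lemma closed_torus_point: "closed {y :: torus2}"
proof -
  have "torus_proj -` (- {y}) = - (\<Inter>i. {x. x $ i - rep_torus2 y $ i \<in> \<int>})"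
    using torus_proj_eq_iff[of _ "rep_torus2 y"] by (auto simp: torus_proj_rep_torus2)
  moreover have "closed {x::real^2. x $ i - rep_torus2 y $ i \<in> \<int>}" for i
  proof -
    have "closed ((\<lambda>x::real^2. x $ i - rep_torus2 y $ i) -` \<int>)"
      by (intro closed_vimage continuous_intros closed_Ints)
    then show ?thesis by (simp add: vimage_def)
  qed
  ultimately show ?thesis
    unfolding closed_def open_torus2_def by auto
qed

section \<open>Iterates of integer matrices and periodicity of rational points\<close>

lemma iter_mat_add: "iter_mat M n (v + w) = iter_mat M n v + iter_mat M n w"
  by (induction n) (auto simp: iter_mat_def matrix_vector_right_distrib)

lemma iter_mat_plus: "iter_mat M (m + n) v = iter_mat M m (iter_mat M n v)"
  by (simp add: iter_mat_def funpow_add)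

lemma continuous_iter_mat: "continuous_on UNIV (iter_mat M n)"
proof (induction n)
  case (Suc n)
  have "continuous_on UNIV (\<lambda>v. M *v iter_mat M n v)"
    by (intro bounded_linear.continuous_on[OF matrix_vector_mul_bounded_linear] Suc)
  then show ?case by (simp add: iter_mat_def o_def)
qed (simp add: iter_mat_def id_def)

text \<open>Integer combinations of integers are integers, so a common denominator of the
  coordinates persists along the whole orbit.\<close>

lemma iter_mat_Ints:
  assumes "\<forall>i. c * v $ i \<in> \<int>"
  shows "\<forall>i. c * iter_mat (map_matrix real_of_int A) n v $ i \<in> \<int>"
proof (induction n)
  case 0 then show ?case using assms by (simp add: iter_mat_def)
next
  case (Suc n)
  let ?v = "iter_mat (map_matrix real_of_int A) n v"
  have "c * (map_matrix real_of_int A *v ?v) $ i = (\<Sum>j\<in>UNIV. of_int (A $ i $ j) * (c * ?v $ j))"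
    for i
    by (simp add: matrix_vector_mult_def sum_distrib_left mult.left_commute)
  moreover have "(\<Sum>j\<in>UNIV. of_int (A $ i $ j) * (c * ?v $ j)) \<in> \<int>" for i
    by (intro Ints_sum Ints_mult[OF Ints_of_int]) (use Suc in blast)
  ultimately show ?case by (simp add: iter_mat_def)
qed

lemma torus_proj_iter_mat_cong:
  "torus_proj x = torus_proj y \<Longrightarrow>
   torus_proj (iter_mat (map_matrix real_of_int A) n x) =
   torus_proj (iter_mat (map_matrix real_of_int A) n y)"
  by (metis toral_map_funpow)

lemma rational_point_in_open:
  fixes U :: "(real^2) set"
  assumes "open U" "U \<noteq> {}"
  obtains p N where "p \<in> U" "N > 0" "\<forall>i. real N * p $ i \<in> \<int>"
proof -
  obtain x where "x \<in> U" using assms by blast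
  \<comment> \<open>Round down to the grid of mesh \<open>1 / Suc n\<close>; the successor keeps the
    denominator positive.\<close>
  define p :: "nat \<Rightarrow> real^2" where "p n = (\<chi> i. of_int \<lfloor>real (Suc n) * x $ i\<rfloor> / real (Suc n))" for n
  have "p \<longlonglongrightarrow> x"
  proof (rule vec_tendstoI)
    fix i
    have "\<bar>p n $ i - x $ i\<bar> \<le> 1 / real (Suc n)" for n
    proof -
      have "\<bar>of_int \<lfloor>real (Suc n) * x $ i\<rfloor> - real (Suc n) * x $ i\<bar> \<le> 1" by linarith
      moreover have "p n $ i - x $ i = (of_int \<lfloor>real (Suc n) * x $ i\<rfloor> - real (Suc n) * x $ i) / real (Suc n)"
        by (simp add: p_def field_simps del: of_nat_Suc)
      ultimately show ?thesis by (simp add: abs_divide divide_right_mono del: of_nat_Suc)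
    qed
    then have "(\<lambda>n. p n $ i - x $ i) \<longlonglongrightarrow> 0"
      by (intro Lim_null_comparison[OF _ LIMSEQ_inverse_real_of_nat])
         (auto simp: inverse_eq_divide)
    then show "(\<lambda>n. p n $ i) \<longlonglongrightarrow> x $ i" by (simp add: LIM_zero_iff)
  qed
  from topological_tendstoD[OF this assms(1) \<open>x \<in> U\<close>] obtain n where "p n \<in> U"
    by (auto simp: eventually_sequentially)
  moreover have "\<forall>i. real (Suc n) * p n $ i \<in> \<int>"
    by (simp add: p_def del: of_nat_Suc)
  ultimately show thesis using that by blast
qed

lemma inj_toral_map:
  assumes "invertible A"
  shows "inj (toral_map A)"
proof -
  obtain B where B: "B ** A = mat 1" using assms by (auto simp: invertible_def)
  have M: "map_matrix real_of_int B ** map_matrix real_of_int A = map_matrix real_of_int (B ** A)"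
    by (simp add: vec_eq_iff matrix_matrix_mult_def)
  have I: "map_matrix real_of_int (mat 1) = mat 1" by (simp add: vec_eq_iff mat_def)
  have "toral_map B (toral_map A y) = y" for y
  proof (induction y rule: torus2.abs_induct)
    case (1 v)
    show ?case
      by (simp add: toral_map.abs_eq matrix_vector_mul_assoc M B I)
  qed
  then show ?thesis by (metis injI)
qed

text \<open>The orbit stays among the finitely many torus points with denominator \<open>N\<close>,
  and an injective map with a finite orbit returns to its start. All multiples of the period are
  recorded so that two points can share one.\<close>

lemma rational_point_periodic:
  assumes A: "invertible A" and N: "N > 0" and p: "\<forall>i. real N * p $ i \<in> \<int>"
  obtains k where "k > 0"
    "\<And>n. torus_proj (iter_mat (map_matrix real_of_int A) (k * n) p) = torus_proj p"
proof -
  let ?M = "map_matrix real_of_int A"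
  define F where "F = (\<lambda>(a, b). torus_proj (vector [real a / N, real b / N])) ` ({..<N} \<times> {..<N})"
  have mem: "torus_proj v \<in> F" if v: "\<forall>i. real N * v $ i \<in> \<int>" for v
  proof -
    define z where "z i = \<lfloor>real N * v $ i\<rfloor>" for i
    have z: "real N * v $ i = of_int (z i)" for i using v by (simp add: z_def)
    \<comment> \<open>Reduce the numerators modulo \<open>N\<close>; the quotients are the integer
      shift between \<open>v\<close> and its representative in \<open>F\<close>.\<close>
    define a where "a i = nat (z i mod int N)" for i
    have "v $ i - real (a i) / N = of_int (z i div int N)" for i
    proof -
      have "int (a i) = z i - int N * (z i div int N)"
        using N by (simp add: a_def minus_mult_div_eq_mod)
      then have "real_of_int (int (a i)) = real_of_int (z i - int N * (z i div int N))"
        by (rule arg_cong)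
      then have "real (a i) = of_int (z i) - real N * of_int (z i div int N)" by simp
      then show ?thesis using z[of i] N by (simp add: field_simps)
    qed
    then have "v $ i - real (a i) / N \<in> \<int>" for i by simp
    then have "torus_proj v = torus_proj (vector [real (a 1) / N, real (a 2) / N])"
      by (simp add: torus_proj_eq_iff forall_2)
    moreover have "a i < N" for i using N by (simp add: a_def nat_less_iff)
    ultimately show ?thesis unfolding F_def by force
  qed
  have "{y. \<exists>n. y = (toral_map A ^^ n) (torus_proj p)} \<subseteq> F"
    using mem iter_mat_Ints[OF p] by (auto simp: toral_map_funpow)
  moreover have "finite F" by (simp add: F_def)
  ultimately have "finite {y. \<exists>n. y = (toral_map A ^^ n) (torus_proj p)}"
    by (rule finite_subset)
  from funpow_inj_finite[OF inj_toral_map[OF A] this] obtain k where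
    k: "k > 0" "(toral_map A ^^ k) (torus_proj p) = torus_proj p" by blast
  have "(toral_map A ^^ (k * n)) (torus_proj p) = torus_proj p" for n
    by (induction n) (auto simp: funpow_add k)
  then show thesis using that k(1) by (simp add: toral_map_funpow)
qed

section \<open>Invariant directions and topological transitivity\<close>

lemma hyperbolic_expanding_eigenvector:
  assumes A: "hyperbolic_matrix A"
  obtains w m where "map_matrix real_of_int A *v w = m *\<^sub>R w" "\<bar>m\<bar> > 1"
    "w \<notin> contracting_eigenline A"
proof -
  let ?M = "map_matrix real_of_int A"
  obtain l m :: real where m: "1 < \<bar>m\<bar>" and tr: "l + m = ?M$1$1 + ?M$2$2"
    and dt: "l * m = ?M$1$1 * ?M$2$2 - ?M$1$2 * ?M$2$1"
    using hyperbolic_real_eigenvalues[OF A] by blast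
  have "(?M$1$1 - m) * (?M$2$2 - m) = ?M$1$2 * ?M$2$1"
    using dt tr by algebra
  then obtain w where w: "w \<noteq> 0" "?M *v w = m *\<^sub>R w"
    using eigenvector_2x2 by (metis scalar_mult_eq_scaleR)
  have "w \<notin> contracting_eigenline A"
  proof
    assume "w \<in> contracting_eigenline A"
    then obtain c where "\<bar>c\<bar> < 1" "m *\<^sub>R w = c *\<^sub>R w"
      using w by (auto simp: contracting_eigenline_def)
    then show False using m w(1) by auto
  qed
  with w m show thesis using that by blast
qed

text \<open>With a normal vector \<open>a\<close>, the parallels to the eigenline are the level sets
  of the inner product with \<open>a\<close>, so intersecting lines becomes solving one linear
  equation.\<close>

lemma contracting_eigenline_hyperplane:
  assumes "hyperbolic_matrix A"
  obtains a where "a \<noteq> 0" "contracting_eigenline A = {x. a \<bullet> x = 0}"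
proof -
  have "dim (contracting_eigenline A) = DIM(real^2) - 1"
    using dim_contracting_eigenline[OF assms] by simp
  then obtain a where "a \<noteq> 0" "span (contracting_eigenline A) = {x. a \<bullet> x = 0}"
    using dim_eq_hyperplane by blast
  then show thesis
    using that subspace_contracting_eigenline[OF assms] span_eq_iff by metis
qed

lemma toral_transitive:
  assumes A: "hyperbolic_matrix A" and U: "open U" "U \<noteq> {}" and V: "open V" "V \<noteq> {}"
  obtains n u where "n \<ge> m" "u \<in> U"
    "torus_proj (iter_mat (map_matrix real_of_int A) n u) \<in> torus_proj ` V"
proof -
  let ?it = "iter_mat (map_matrix real_of_int A)"
  have inv: "invertible A" using A by (simp add: hyperbolic_matrix_def)
  obtain p N where p: "p \<in> U" "N > 0" "\<forall>i. real N * p $ i \<in> \<int>"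
    using rational_point_in_open[OF U] .
  obtain q N' where q: "q \<in> V" "N' > 0" "\<forall>i. real N' * q $ i \<in> \<int>"
    using rational_point_in_open[OF V] .
  obtain kp where kp: "kp > 0" "\<And>n. torus_proj (?it (kp * n) p) = torus_proj p"
    using rational_point_periodic[OF inv p(2,3)] by blast
  obtain kq where kq: "kq > 0" "\<And>n. torus_proj (?it (kq * n) q) = torus_proj q"
    using rational_point_periodic[OF inv q(2,3)] by blast
  \<comment> \<open>A common period of \<open>p\<close> and \<open>q\<close> on the torus.\<close>
  define k where "k = kp * kq"
  have k: "k > 0" "torus_proj (?it (k * n) p) = torus_proj p"
    "torus_proj (?it (k * n) q) = torus_proj q" for n
    using kp kq kp(2)[of "kq * n"] kq(2)[of "kp * n"] by (auto simp: k_def mult_ac)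
  obtain w c where w: "map_matrix real_of_int A *v w = c *\<^sub>R w" "\<bar>c\<bar> > 1"
    and wn: "w \<notin> contracting_eigenline A"
    using hyperbolic_expanding_eigenvector[OF A] .
  obtain a where a: "contracting_eigenline A = {x. a \<bullet> x = 0}"
    using contracting_eigenline_hyperplane[OF A] by blast
  \<comment> \<open>Solves \<open>a \<bullet> s = 0\<close>: the expanding line through
    \<open>p\<close> meets the contracting line through \<open>q\<close> at
    \<open>p + b *\<^sub>R w = q + s\<close>.\<close>
  define b where "b = a \<bullet> (q - p) / (a \<bullet> w)"
  define s where "s = p + b *\<^sub>R w - q"
  have "a \<bullet> s = 0"
    using wn by (simp add: a s_def b_def inner_diff_right inner_add_right)
  then have s0: "(\<lambda>n. ?it n s) \<longlonglongrightarrow> 0"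
    using contracting_eigenline_dynamic[OF A, of s] a by simp
  have sub: "strict_mono (\<lambda>n. k * n)" using k(1) by (simp add: strict_mono_def)
  \<comment> \<open>At multiples of \<open>k\<close>, the point that reaches the class of
    \<open>p + b *\<^sub>R w\<close> after \<open>n\<close> steps; it tends to \<open>p\<close>
    because \<open>\<bar>c\<bar> > 1\<close>.\<close>
  define u where "u n = p + (b * (1 / c) ^ n) *\<^sub>R w" for n
  have "u \<longlonglongrightarrow> p + (b * 0) *\<^sub>R w"
    unfolding u_def using w(2)
    by (intro tendsto_intros LIMSEQ_power_zero) simp
  then have "u \<longlonglongrightarrow> p" by simp
  then have "(\<lambda>n. u (k * n)) \<longlonglongrightarrow> p"
    using LIMSEQ_subseq_LIMSEQ[OF _ sub] by (simp add: o_def)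
  then have 1: "\<forall>\<^sub>F n in sequentially. u (k * n) \<in> U"
    using topological_tendstoD U(1) p(1) by blast
  have "(\<lambda>n. q + ?it (k * n) s) \<longlonglongrightarrow> q + 0"
    using LIMSEQ_subseq_LIMSEQ[OF s0 sub] by (intro tendsto_intros) (simp add: o_def)
  then have 2: "\<forall>\<^sub>F n in sequentially. q + ?it (k * n) s \<in> V"
    using topological_tendstoD V(1) q(1) by fastforce
  have "\<forall>\<^sub>F n in sequentially. u (k * n) \<in> U \<and> q + ?it (k * n) s \<in> V \<and> n \<ge> m"
    using 1 2 eventually_ge_at_top by eventually_elim auto
  then obtain n where n: "u (k * n) \<in> U" "q + ?it (k * n) s \<in> V" "n \<ge> m"
    by (auto simp: eventually_sequentially)
  have "?it (k * n) (u (k * n)) = ?it (k * n) p + b *\<^sub>R w"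
    using w(2) by (auto simp: u_def iter_mat_add iter_mat_scaleR iter_mat_eig[OF w(1)] power_divide)
  then have "torus_proj (?it (k * n) (u (k * n))) = torus_proj (p + b *\<^sub>R w)"
    using torus_proj_add_cong[OF k(2)] by simp
  also have "p + b *\<^sub>R w = q + s" by (simp add: s_def)
  \<comment> \<open>The first \<open>k * n\<close> steps lead to \<open>q + s\<close>; in the next
    \<open>k * n\<close> steps \<open>q\<close> returns to itself on the torus while
    \<open>s\<close> shrinks.\<close>
  finally have "torus_proj (?it (k * n + k * n) (u (k * n))) = torus_proj (?it (k * n) q + ?it (k * n) s)"
    using torus_proj_iter_mat_cong by (metis iter_mat_plus iter_mat_add)
  also have "\<dots> = torus_proj (q + ?it (k * n) s)"
    using torus_proj_add_cong[OF k(3)] .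
  finally have "torus_proj (?it (k * n + k * n) (u (k * n))) \<in> torus_proj ` V"
    using n(2) by simp
  moreover have "k * n + k * n \<ge> m"
    using n(3) k(1) by (simp add: trans_le_add1 le_trans[OF _ mult_le_mono1[of 1 k n]])
  ultimately show thesis using that n(1) by blast
qed

section \<open>Dense and nondense orbits under translation along the contracting eigenline\<close>

text \<open>Density can be tested with open sets of the plane because \<open>torus_proj\<close> is
  open, continuous and onto.\<close>

lemma D_toral_map_iff:
  "torus_proj x \<in> D (toral_map A) \<longleftrightarrow>
   (\<forall>V. open V \<and> V \<noteq> {} \<longrightarrow>
      (\<exists>n. torus_proj (iter_mat (map_matrix real_of_int A) n x) \<in> torus_proj ` V))"
  (is "_ \<longleftrightarrow> ?R")
proof
  assume L: "torus_proj x \<in> D (toral_map A)"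
  show ?R
  proof (intro allI impI)
    fix V :: "(real^2) set" assume V: "open V \<and> V \<noteq> {}"
    then obtain v where "v \<in> V" by blast
    moreover have "torus_proj v \<in> closure (range (\<lambda>n. (toral_map A ^^ n) (torus_proj x)))"
      using L by (simp add: D_def)
    ultimately have "range (\<lambda>n. (toral_map A ^^ n) (torus_proj x)) \<inter> torus_proj ` V \<noteq> {}"
      using V open_torus_proj_image open_Int_closure_eq_empty by blast
    then show "\<exists>n. torus_proj (iter_mat (map_matrix real_of_int A) n x) \<in> torus_proj ` V"
      by (auto simp: toral_map_funpow)
  qed
next
  assume R: ?R
  have "y \<in> closure (range (\<lambda>n. (toral_map A ^^ n) (torus_proj x)))" for y
    unfolding closure_iff_nhds_not_empty
  proof (intro allI impI)
    fix W W' assume W: "W' \<subseteq> W" "open W'" "y \<in> W'"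
    obtain v where v: "y = torus_proj v"
      by (metis torus_proj_rep_torus2)
    have "open (torus_proj -` W')" "torus_proj -` W' \<noteq> {}"
      using W v by (auto simp: open_torus2_def)
    with R obtain n where
      "torus_proj (iter_mat (map_matrix real_of_int A) n x) \<in> torus_proj ` (torus_proj -` W')"
      by meson
    then have "torus_proj (iter_mat (map_matrix real_of_int A) n x) \<in> W'" by auto
    then show "range (\<lambda>n. (toral_map A ^^ n) (torus_proj x)) \<inter> W \<noteq> {}"
      using W by (auto simp: toral_map_funpow)
  qed
  then show "torus_proj x \<in> D (toral_map A)" by (auto simp: D_def)
qed

text \<open>Modulo 1, \<open>N\<close> times the first coordinate of the orbit of
  \<open>p + t\<close> comes only from the \<open>t\<close> part, which tends to 0. Late iterates
  therefore miss the open set \<open>W\<close>.\<close>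

lemma ND_rational_plus_contracting:
  assumes A: "hyperbolic_matrix A" and N: "N > 0" and p: "\<forall>i. real N * p $ i \<in> \<int>"
    and t: "t \<in> contracting_eigenline A"
  shows "torus_proj (p + t) \<in> ND (toral_map A)"
proof -
  let ?it = "iter_mat (map_matrix real_of_int A)"
  define W :: "(real^2) set" where "W = {y. 1/4 < real N * y $ 1 \<and> real N * y $ 1 < 3/4}"
  have "(\<lambda>n. ?it n t $ 1) \<longlonglongrightarrow> 0"
    using tendsto_vec_nth[of _ 0 sequentially 1] contracting_eigenline_dynamic[OF A, of t] t by simp
  then have "(\<lambda>n. real N * ?it n t $ 1) \<longlonglongrightarrow> real N * 0" by (intro tendsto_intros)
  from tendstoD[OF this, of "1/4"] obtain m where m: "\<And>n. n \<ge> m \<Longrightarrow> \<bar>real N * ?it n t $ 1\<bar> < 1/4"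
    by (auto simp: eventually_sequentially)
  \<comment> \<open>The early iterates, where the \<open>t\<close> part may still be large; removing
    these finitely many points leaves \<open>V\<close> open and nonempty.\<close>
  define F where "F = (\<lambda>n. torus_proj (?it n (p + t))) ` {..<m}"
  have F: "finite F" by (simp add: F_def)
  define V where "V = W - torus_proj -` F"
  have "open W" unfolding W_def
    by (intro open_Collect_conj open_Collect_less continuous_intros)
  moreover have "closed F"
    using closed_UN[OF F, of "\<lambda>y. {y}"] closed_torus_point by simp
  then have "closed (torus_proj -` F)"
    unfolding closed_def open_torus2_def by (simp add: vimage_Compl)
  ultimately have oV: "open V" unfolding V_def by auto
  have "(\<chi> i. 1 / (2 * real N)) \<in> W" using N by (simp add: W_def)
  then have nV: "V \<noteq> {}"
    unfolding V_def using open_minus_countable_nonempty[OF \<open>open W\<close>]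
      countable_torus_proj_vimage[OF countable_finite[OF F]] by blast
  have "torus_proj (?it n (p + t)) \<notin> torus_proj ` V" for n
  proof
    assume "torus_proj (?it n (p + t)) \<in> torus_proj ` V"
    then obtain v where v: "v \<in> V" "torus_proj (?it n (p + t)) = torus_proj v" by blast
    then have "torus_proj (?it n (p + t)) \<notin> F" by (auto simp: V_def)
    then have "n \<ge> m" by (auto simp: F_def not_le[symmetric])
    then have small: "\<bar>real N * ?it n t $ 1\<bar> < 1/4" by (rule m)
    have "v $ 1 - ?it n (p + t) $ 1 \<in> \<int>" using v(2) by (metis torus_proj_eq_iff)
    then have "real N * (v $ 1 - ?it n (p + t) $ 1) + real N * ?it n p $ 1 \<in> \<int>"
      by (intro Ints_add Ints_mult[OF Ints_of_nat] iter_mat_Ints[OF p, rule_format])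
    then obtain j where "real N * v $ 1 - real N * ?it n t $ 1 = of_int j"
      by (auto simp: iter_mat_add algebra_simps elim!: Ints_cases)
    moreover have "1/4 < real N * v $ 1" "real N * v $ 1 < 3/4"
      using v(1) by (auto simp: V_def W_def)
    ultimately have "0 < real_of_int j" "real_of_int j < 1" using small by linarith+
    then show False by simp
  qed
  then have "torus_proj (p + t) \<notin> D (toral_map A)"
    unfolding D_toral_map_iff using oV nV by blast
  then show ?thesis by (simp add: D_def ND_def)
qed

text \<open>The shift \<open>s\<close> is below \<open>e/2\<close> only from some time on, so visits
  of \<open>q\<close> at arbitrarily late times are required; such a visit to the half ball is a
  visit of \<open>q + s\<close> to the full ball.\<close>

lemma D_recurrent_plus_contracting:
  assumes A: "hyperbolic_matrix A" and s: "s \<in> contracting_eigenline A"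
    and q: "\<And>V m. open V \<Longrightarrow> V \<noteq> {} \<Longrightarrow>
      \<exists>n\<ge>m. torus_proj (iter_mat (map_matrix real_of_int A) n q) \<in> torus_proj ` V"
  shows "torus_proj (q + s) \<in> D (toral_map A)"
  unfolding D_toral_map_iff
proof (intro allI impI)
  let ?it = "iter_mat (map_matrix real_of_int A)"
  fix V :: "(real^2) set" assume V: "open V \<and> V \<noteq> {}"
  then obtain v e where e: "e > 0" "ball v e \<subseteq> V"
    by (meson ex_in_conv openE)
  have "(\<lambda>n. ?it n s) \<longlonglongrightarrow> 0"
    using contracting_eigenline_dynamic[OF A, of s] s by simp
  from tendstoD[OF this, of "e/2"] e(1) obtain m where m: "\<And>n. n \<ge> m \<Longrightarrow> norm (?it n s) < e/2"
    by (auto simp: eventually_sequentially)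
  obtain n u where n: "n \<ge> m" "u \<in> ball v (e/2)" "torus_proj (?it n q) = torus_proj u"
    using q[of "ball v (e/2)" m] e(1) by auto
  have "u + ?it n s \<in> ball v e"
    using n(2) m[OF n(1)] norm_triangle_ineq4[of "v - u" "?it n s"]
    by (simp add: dist_norm algebra_simps)
  moreover have "torus_proj (?it n (q + s)) = torus_proj (u + ?it n s)"
    using torus_proj_add_cong[OF n(3)] by (simp add: iter_mat_add)
  ultimately show "\<exists>n. torus_proj (?it n (q + s)) \<in> torus_proj ` V"
    using e(2) by blast
qed

section \<open>Recurrent points by Baire category\<close>

lemma recurrent_point_off_lines:
  assumes A: "hyperbolic_matrix A" and U: "open U" "U \<noteq> {}" and C: "countable C" and a: "a \<noteq> 0"
  obtains q where "q \<in> U" "\<And>c. c \<in> C \<Longrightarrow> a \<bullet> q \<noteq> a \<bullet> c"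
    "\<And>V m. open V \<Longrightarrow> V \<noteq> {} \<Longrightarrow>
      \<exists>n\<ge>m. torus_proj (iter_mat (map_matrix real_of_int A) n q) \<in> torus_proj ` V"
proof -
  let ?it = "iter_mat (map_matrix real_of_int A)"
  obtain B :: "(real^2) set set" where B: "countable B" "topological_basis B"
    using ex_countable_basis by blast
  define G where "G V m = {x. \<exists>n\<ge>m. torus_proj (?it n x) \<in> torus_proj ` V}" for V m
  define H where "H c = {x. a \<bullet> x \<noteq> a \<bullet> c}" for c
  \<comment> \<open>A countable basis keeps the family countable. Each \<open>G V m\<close> is dense
    by transitivity at times beyond \<open>m\<close>, which fails for empty \<open>V\<close>; each
    \<open>H c\<close> is the complement of a line.\<close>
  define \<G> where "\<G> = case_prod G ` ((B - {{}}) \<times> UNIV) \<union> H ` C"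
  have "UNIV \<subseteq> closure (\<Inter>\<G>)"
  proof (rule Baire)
    show "countable \<G>" unfolding \<G>_def using B(1) C by auto
    fix X assume "X \<in> \<G>"
    then consider V m where "V \<in> B" "V \<noteq> {}" "X = G V m" | c where "X = H c"
      by (auto simp: \<G>_def)
    then have "open X \<and> closure X = UNIV"
    proof cases
      case 1
      have oV: "open V" using 1 B(2) topological_basis_open by blast
      have "G V m = (\<Union>n\<in>{m..}. ?it n -` torus_proj -` torus_proj ` V)"
        by (auto simp: G_def)
      moreover have "open (torus_proj -` torus_proj ` V)"
        using open_torus_proj_image[OF oV] by (simp add: open_torus2_def)
      ultimately have "open (G V m)"
        using continuous_iter_mat by (auto intro!: open_UN open_vimage)
      moreover have "y \<in> closure (G V m)" for y
        unfolding closure_iff_nhds_not_empty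
      proof (intro allI impI)
        fix W W' assume W: "W' \<subseteq> W" "open W'" "y \<in> W'"
        then obtain n u where "n \<ge> m" "u \<in> W'" "torus_proj (?it n u) \<in> torus_proj ` V"
          using toral_transitive[OF A _ _ oV] 1(2) by (metis empty_iff)
        then show "G V m \<inter> W \<noteq> {}" using W(1) by (auto simp: G_def)
      qed
      ultimately show ?thesis using 1 by auto
    next
      case 2
      have H: "H c = - {x. a \<bullet> x = a \<bullet> c}" by (auto simp: H_def)
      then show ?thesis
        using 2 a by (simp add: closure_complement interior_hyperplane closed_hyperplane flip: closed_def)
    qed
    then show "openin (top_of_set UNIV) X \<and> UNIV \<subseteq> closure X" by simp
  qed auto
  then have "U \<inter> closure (\<Inter>\<G>) \<noteq> {}" using U(2) by auto
  then have "U \<inter> \<Inter>\<G> \<noteq> {}" by (simp only: open_Int_closure_eq_empty[OF U(1)] not_False_eq_True)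
  then obtain q where q: "q \<in> U" "q \<in> \<Inter>\<G>" by blast
  show thesis
  proof
    show "q \<in> U" by (rule q)
    show "a \<bullet> q \<noteq> a \<bullet> c" if "c \<in> C" for c
      using q(2) that by (auto simp: \<G>_def H_def)
    fix V :: "(real^2) set" and m assume V: "open V" "V \<noteq> {}"
    then obtain V' where V': "V' \<in> B" "V' \<noteq> {}" "V' \<subseteq> V"
      using topological_basisE[OF B(2)] by (metis empty_iff ex_in_conv)
    then have "G V' m \<in> \<G>" by (force simp: \<G>_def)
    then have "q \<in> G V' m" using q(2) by blast
    then show "\<exists>n\<ge>m. torus_proj (?it n q) \<in> torus_proj ` V"
      using V'(3) by (auto simp: G_def)
  qed
qed

section \<open>Intersection of transverse lines, density and uncountability\<close>

text \<open>The free countable set \<open>C\<close> serves two ends: empty, it gives density; equal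
  to the preimage of the intersection, it refutes countability.\<close>

lemma ND_Int_D_not_countable_near:
  assumes A: "hyperbolic_matrix A" and B: "hyperbolic_matrix B"
    and ne: "contracting_eigenline A \<noteq> contracting_eigenline B"
    and U: "open U" "U \<noteq> {}" and C: "countable C"
  obtains x where "x \<in> U" "x \<notin> C" "torus_proj x \<in> ND (toral_map A) \<inter> D (toral_map B)"
proof -
  obtain a where a: "a \<noteq> 0" "contracting_eigenline B = {x. a \<bullet> x = 0}"
    using contracting_eigenline_hyperplane[OF B] .
  \<comment> \<open>Both eigenlines have dimension one, so inclusion would force equality.\<close>
  have "\<not> contracting_eigenline A \<subseteq> contracting_eigenline B"
    using ne subspace_dim_equal[OF subspace_contracting_eigenline[OF A] subspace_contracting_eigenline[OF B]]
      dim_contracting_eigenline[OF A] dim_contracting_eigenline[OF B] by auto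
  then obtain t where t: "t \<in> contracting_eigenline A" "a \<bullet> t \<noteq> 0"
    using a by blast
  obtain p N where p: "p \<in> U" "N > 0" "\<forall>i. real N * p $ i \<in> \<int>"
    using rational_point_in_open[OF U] .
  \<comment> \<open>The projection of \<open>q\<close> onto the line \<open>p + \<real> t\<close>
    along the contracting direction of \<open>B\<close>. It is continuous and fixes
    \<open>p\<close>, so \<open>q\<close> near \<open>p\<close> keeps \<open>g q\<close> in
    \<open>U\<close>.\<close>
  define g where "g q = p + (a \<bullet> (q - p) / (a \<bullet> t)) *\<^sub>R t" for q
  have "continuous_on UNIV g" unfolding g_def by (intro continuous_intros) (use t in auto)
  then have "open (g -` U)" using U(1) by (simp add: open_vimage)
  moreover have "p \<in> g -` U" using p(1) by (simp add: g_def)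
  ultimately obtain q where q: "g q \<in> U" "\<And>c. c \<in> C \<Longrightarrow> a \<bullet> q \<noteq> a \<bullet> c"
    "\<And>V m. open V \<Longrightarrow> V \<noteq> {} \<Longrightarrow>
      \<exists>n\<ge>m. torus_proj (iter_mat (map_matrix real_of_int B) n q) \<in> torus_proj ` V"
    using recurrent_point_off_lines[OF B, of "g -` U" C a] C a(1) by (metis empty_iff vimage_eq)
  \<comment> \<open>Moving from \<open>q\<close> to \<open>g q\<close> stays on one level line of
    \<open>a\<close>, which passes through no point of \<open>C\<close>; hence \<open>g q\<close> is
    outside \<open>C\<close>.\<close>
  have gq: "a \<bullet> g q = a \<bullet> q"
    using t(2) by (simp add: g_def inner_add_right inner_diff_right)
  have "torus_proj (g q) \<in> ND (toral_map A)"
    unfolding g_def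
    by (intro ND_rational_plus_contracting[OF A p(2,3)]
        subspace_scale[OF subspace_contracting_eigenline[OF A]] t(1))
  moreover have "g q - q \<in> contracting_eigenline B"
    using gq by (simp add: a inner_diff_right)
  from D_recurrent_plus_contracting[OF B this q(3)]
  have "torus_proj (g q) \<in> D (toral_map B)" by simp
  ultimately show thesis using that q(1) q(2)[of "g q"] gq by auto
qed

theorem theorem1p1:
  fixes T S :: "torus2 \<Rightarrow> torus2"
  assumes "hyperbolic_toral_automorphism T"
    and "hyperbolic_toral_automorphism S"
    and "immersed_dim (stable_manifold T \<inter> stable_manifold S) = 0"
  shows "closure (ND T \<inter> D S) = UNIV \<and> uncountable (ND T \<inter> D S)"
proof -
  obtain A B where A: "hyperbolic_matrix A" "T = toral_map A"
    and B: "hyperbolic_matrix B" "S = toral_map B"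
    using assms(1,2) unfolding hyperbolic_toral_automorphism_def by blast
  have ne: "contracting_eigenline A \<noteq> contracting_eigenline B"
    using assms(3) immersed_dim_stable_eq_0_iff[OF A(1) B(1)] A(2) B(2) by simp
  note near = ND_Int_D_not_countable_near[OF A(1) B(1) ne, folded A(2) B(2)]
  have "y \<in> closure (ND T \<inter> D S)" for y
    unfolding closure_iff_nhds_not_empty
  proof (intro allI impI)
    fix W W' assume W: "W' \<subseteq> W" "open W'" "y \<in> W'"
    obtain v where "y = torus_proj v"
      by (metis torus_proj_rep_torus2)
    then have "open (torus_proj -` W')" "torus_proj -` W' \<noteq> {}"
      using W by (auto simp: open_torus2_def)
    then obtain x where "x \<in> torus_proj -` W'" "torus_proj x \<in> ND T \<inter> D S"
      using near[of _ "{}"] by blast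
    then show "ND T \<inter> D S \<inter> W \<noteq> {}" using W(1) by blast
  qed
  moreover have "uncountable (ND T \<inter> D S)"
  proof
    assume "countable (ND T \<inter> D S)"
    \<comment> \<open>Avoiding the full preimage of the intersection would produce a point whose
      image is both inside and outside it.\<close>
    from near[OF open_UNIV _ countable_torus_proj_vimage[OF this]]
    show False by auto
  qed
  ultimately show ?thesis by auto
qed

end
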